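(* Let $K$ be a finite set of upper triangular $2\times 2$ real matrices, regarded as a finite subset of $\mathbb{R}^3$ by identifying $\begin{pmatrix} x & z\\ 0 & y\end{pmatrix}$ with $(x,y,z)$. Then the rank-one convex hull $\operatorname{conv}_{\mathrm{rc}} K\subset\mathbb{R}^3$ is a semialgebraic set described by finitely many linear and quadratic polynomials; that is, it is a boolean combination (finite unions and intersections) of finitely many polynomial inequalities in which every polynomial is linear (affine) or quadratic in $(x,y,z)$.
   Context: Identify the space of upper triangular $2\times2$ real matrices $\begin{pmatrix} x & z\\ 0 & y\end{pmatrix}$ with $\mathbb{R}^3$ with coordinates $(x,y,z)$. The cone of matrices of rank at most one is $\mathcal{D}=\{xy=0\}\subset\mathbb{R}^3$. A function $f:\mathbb{R}^3\to\mathbb{R}$ is rank-one convex if $t\mapsto f(A+tB)$ is convex for every $A\in\mathbb{R}^3$ and every $B\in\mathcal{D}$. For a compact set $K\subset\mathbb{R}^3$, the rank-one convex hull is $$\operatorname{conv}_{\mathrm{rc}}K=\{A\in\mathbb{R}^3 : f(A)\le \max f(K)\ \text{for all rank-one convex } f:\mathbb{R}^3\to\mathbb{R}\}.$$ A subset of a real vector space is semialgebraic if it can be described as a boolean combination (unions and intersections) of finitely many polynomial inequalities. *)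

theory Defs
  imports "HOL-Analysis.Analysis"
begin

section \<open>Upper triangular matrices as points of three-space\<close>

definition upper_triangular2 :: "real^2^2 \<Rightarrow> bool"
  where "upper_triangular2 A \<longleftrightarrow> A $ 2 $ 1 = 0"

text \<open>The matrix with rows (x, z) and (0, y) has coordinates (x, y, z): the diagonal comes first.\<close>

definition tri_coords :: "real^2^2 \<Rightarrow> real^3"
  where "tri_coords A = vector [A $ 1 $ 1, A $ 2 $ 2, A $ 1 $ 2]"

definition rank_one_cone :: "(real^3) set"
  where "rank_one_cone = {v. v $ 1 * v $ 2 = 0}"

lemma tri_coords_mem_rank_one_cone:
  assumes "upper_triangular2 A"
  shows "tri_coords A \<in> rank_one_cone \<longleftrightarrow> rank A \<le> 1"
proof -
  have "rank A \<le> 2"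
    using rank_bound[of A] by simp
  moreover have "det A = 0 \<longleftrightarrow> rank A < 2"
    using det_eq_0_rank[of A] by simp
  moreover have "det A = A $ 1 $ 1 * A $ 2 $ 2"
    using assms by (simp add: det_2 upper_triangular2_def)
  ultimately show ?thesis
    by (auto simp: rank_one_cone_def tri_coords_def)
qed

lemma bij_betw_tri_coords: "bij_betw tri_coords {A. upper_triangular2 A} UNIV"
proof (rule bij_betwI')
  fix A B :: "real^2^2"
  assume "A \<in> {A. upper_triangular2 A}" "B \<in> {A. upper_triangular2 A}"
  then show "tri_coords A = tri_coords B \<longleftrightarrow> A = B"
    by (auto simp: tri_coords_def upper_triangular2_def vec_eq_iff forall_2 forall_3)
next
  fix v :: "real^3"
  let ?A = "vector [vector [v $ 1, v $ 3], vector [0, v $ 2]] :: real^2^2"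
  have "v = tri_coords ?A"
    by (simp add: tri_coords_def vec_eq_iff forall_3)
  moreover have "upper_triangular2 ?A"
    by (simp add: upper_triangular2_def)
  ultimately show "\<exists>A\<in>{A. upper_triangular2 A}. v = tri_coords A"
    by blast
qed simp


section \<open>Rank-one convexity\<close>

definition rank_one_convex :: "(real^3 \<Rightarrow> real) \<Rightarrow> bool"
  where "rank_one_convex f \<longleftrightarrow>
    (\<forall>A. \<forall>B\<in>rank_one_cone. convex_on UNIV (\<lambda>t::real. f (A + t *\<^sub>R B)))"

text \<open>The supremum is the maximum of f on K whenever K is nonempty and compact, since rank-one
  convex functions are continuous. For empty K the hull is empty, because constants are
  rank-one convex.\<close>

definition rank_one_hull :: "(real^3) set \<Rightarrow> (real^3) set"
  where "rank_one_hull K = {A. \<forall>f. rank_one_convex f \<longrightarrow> f A \<le> (SUP B\<in>K. f B)}"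

lemma rank_one_hull_empty: "rank_one_hull {} = {}"
proof -
  have const: "rank_one_convex (\<lambda>_. c)" for c
    by (simp add: rank_one_convex_def convex_on_const)
  have "\<not> (\<forall>f. rank_one_convex f \<longrightarrow> f A \<le> (SUP B\<in>{}. f B))" for A :: "real^3"
    using const[of "Sup {} + 1"] by force
  then show ?thesis
    by (simp add: rank_one_hull_def)
qed


section \<open>Semialgebraic sets\<close>

text \<open>Real polynomial functions in n variables of total degree at most d, written as linear
  combinations of monomials with exponent vectors a.\<close>

definition polynomial_deg_le :: "nat \<Rightarrow> (real^'n \<Rightarrow> real) \<Rightarrow> bool"
  where "polynomial_deg_le d p \<longleftrightarrow>
    (\<exists>c. \<forall>v. p v = (\<Sum>a\<in>{a::'n \<Rightarrow> nat. (\<Sum>i\<in>UNIV. a i) \<le> d}. c a * (\<Prod>i\<in>UNIV. v $ i ^ a i)))"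

lemma finite_exponents: "finite {a::'n::finite \<Rightarrow> nat. (\<Sum>i\<in>UNIV. a i) \<le> d}"
proof (rule finite_subset)
  have "a i \<le> d" if "(\<Sum>i\<in>UNIV. a i) \<le> d" for a :: "'n \<Rightarrow> nat" and i
    using member_le_sum[of i UNIV a] that by simp
  then show "{a::'n \<Rightarrow> nat. (\<Sum>i\<in>UNIV. a i) \<le> d} \<subseteq> (UNIV \<rightarrow>\<^sub>E {..d})"
    unfolding PiE_UNIV_domain by blast
  show "finite ((UNIV :: 'n set) \<rightarrow>\<^sub>E {..d})"
    by (rule finite_PiE) simp_all
qed

text \<open>No rule for complements is needed: with both strict and non-strict inequalities and
  polynomials closed under negation, complements can be pushed to the atoms.\<close>

inductive boolean_combination :: "(real^'n \<Rightarrow> real) set \<Rightarrow> (real^'n) set \<Rightarrow> bool"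
  for P :: "(real^'n \<Rightarrow> real) set" where
  nonneg: "p \<in> P \<Longrightarrow> boolean_combination P {v. p v \<ge> 0}"
| pos: "p \<in> P \<Longrightarrow> boolean_combination P {v. p v > 0}"
| union: "boolean_combination P S \<Longrightarrow> boolean_combination P T \<Longrightarrow> boolean_combination P (S \<union> T)"
| inter: "boolean_combination P S \<Longrightarrow> boolean_combination P T \<Longrightarrow> boolean_combination P (S \<inter> T)"

definition semialgebraic_deg_le :: "nat \<Rightarrow> (real^'n) set \<Rightarrow> bool"
  where "semialgebraic_deg_le d S \<longleftrightarrow>
    (\<exists>P. finite P \<and> (\<forall>p\<in>P. polynomial_deg_le d p) \<and> boolean_combination P S)"

end

theory Submission
  imports Defs
begin

text \<open>A function is rank-one convex exactly when it is jointly convex in (x, z) for fixed y and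
  jointly convex in (y, z) for fixed x. Both are used through the fibres of the hull H over the
  diagonal: H(x, y) is the set of all z with (x, y, z) in H. Every fibre is a compact interval,
  possibly empty, because z is bounded on H, segments in the z-direction with ends in H stay in H,
  and rank-one convex functions are continuous along such lines (\<open>fibre_interval\<close>).

  The key fact (\<open>fibre_strip\<close>) is that if no point of K has its first coordinate strictly between
  a and b, then fibres interpolate linearly across that strip: for x = (1 - t) a + t b with 0 < t < 1,
  H(x, y) = (1 - t) H(a, y) + t H(b, y) as a Minkowski sum. One inclusion holds because segments in
  rank-one directions with ends in H stay in H. For the other, a rank-one convex function f can be
  replaced inside the strip by the greatest function allowed by its values on the two bounding
  planes, namely the infimum of (1 - t) f(a, y, z0) + t f(b, y, z1) over (1 - t) z0 + t z1 = z. The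
  result is again rank-one convex (\<open>rank_one_convex_chordal_extension\<close>) and agrees with f on K. If
  z is outside the Minkowski sum, then every splitting of z has an end outside H, so
  some function vanishing on K is positive there; by compactness a finite sum of such functions
  is bounded away from zero over all splittings at once (\<open>separator_chord_positive\<close>), so its
  extension separates (x, y, z) from K.

  By symmetry the same holds in the y-direction. Now cut the plane of diagonals along the finitely
  many coordinates of points of K. Over each cell of this grid, H is empty as soon as one corner
  fibre is, and otherwise it lies between the two bilinear interpolations of the lower and upper ends
  of the four corner intervals. A bilinear interpolation is a polynomial of degree two, and the cells
  are bounded by affine inequalities.\<close>

section \<open>Polynomials and semialgebraic sets\<close>

lemma polynomial_deg_le_add:
  assumes "polynomial_deg_le d p" "polynomial_deg_le d q"
  shows "polynomial_deg_le d (\<lambda>v. p v + q v)"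
proof -
  obtain c e where
    "\<And>v. p v = (\<Sum>a\<in>{a. (\<Sum>i\<in>UNIV. a i) \<le> d}. c a * (\<Prod>i\<in>UNIV. v $ i ^ a i))"
    "\<And>v. q v = (\<Sum>a\<in>{a. (\<Sum>i\<in>UNIV. a i) \<le> d}. e a * (\<Prod>i\<in>UNIV. v $ i ^ a i))"
    using assms unfolding polynomial_deg_le_def by blast
  then show ?thesis
    unfolding polynomial_deg_le_def
    by (intro exI[of _ "\<lambda>a. c a + e a"]) (simp add: sum.distrib distrib_right)
qed

lemma polynomial_deg_le_scale:
  assumes "polynomial_deg_le d p"
  shows "polynomial_deg_le d (\<lambda>v. k * p v)"
proof -
  obtain c where
    "\<And>v. p v = (\<Sum>a\<in>{a. (\<Sum>i\<in>UNIV. a i) \<le> d}. c a * (\<Prod>i\<in>UNIV. v $ i ^ a i))"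
    using assms unfolding polynomial_deg_le_def by blast
  then show ?thesis
    unfolding polynomial_deg_le_def
    by (intro exI[of _ "\<lambda>a. k * c a"]) (simp add: sum_distrib_left mult.assoc)
qed

lemma polynomial_deg_le_monomial:
  fixes a :: "'n::finite \<Rightarrow> nat"
  assumes "(\<Sum>i\<in>UNIV. a i) \<le> d"
  shows "polynomial_deg_le d (\<lambda>v. \<Prod>i\<in>UNIV. v $ i ^ a i)"
  unfolding polynomial_deg_le_def
proof (intro exI allI)
  fix v :: "real^'n"
  let ?E = "{a::'n \<Rightarrow> nat. (\<Sum>i\<in>UNIV. a i) \<le> d}"
  have "(\<Sum>b\<in>?E. (if b = a then 1 else 0) * (\<Prod>i\<in>UNIV. v $ i ^ b i))
      = (\<Sum>b\<in>?E. if b = a then (\<Prod>i\<in>UNIV. v $ i ^ b i) else 0)"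
    by (rule sum.cong) auto
  also have "\<dots> = (\<Prod>i\<in>UNIV. v $ i ^ a i)"
    using assms by (simp add: sum.delta finite_exponents)
  finally show "(\<Prod>i\<in>UNIV. v $ i ^ a i)
      = (\<Sum>b\<in>?E. (if b = a then 1 else 0) * (\<Prod>i\<in>UNIV. v $ i ^ b i))" ..
qed

lemma polynomial_deg_le_const: "polynomial_deg_le d (\<lambda>v::real^'n::finite. k)"
  using polynomial_deg_le_scale[OF polynomial_deg_le_monomial[of "\<lambda>_. 0"], of d k] by simp

lemma prod_power_delta:
  fixes v :: "real^'n::finite"
  shows "(\<Prod>k\<in>UNIV. v $ k ^ (if k = i then 1 else 0)) = v $ i"
proof -
  have "(\<Prod>k\<in>UNIV. v $ k ^ (if k = i then 1 else 0)) = (\<Prod>k\<in>UNIV. if k = i then v $ k else 1)"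
    by (rule prod.cong) auto
  then show ?thesis by (simp add: prod.delta)
qed

lemma polynomial_deg_le_coordinate:
  assumes "1 \<le> d"
  shows "polynomial_deg_le d (\<lambda>v::real^'n::finite. v $ i)"
  using polynomial_deg_le_monomial[of "\<lambda>k. if k = i then 1 else 0" d] assms
  unfolding prod_power_delta by simp

lemma polynomial_deg_le_coordinate_mult:
  assumes "2 \<le> d"
  shows "polynomial_deg_le d (\<lambda>v::real^'n::finite. v $ i * v $ j)"
  using polynomial_deg_le_monomial[of "\<lambda>k. (if k = i then 1 else 0) + (if k = j then 1 else 0)" d] assms
  unfolding power_add prod.distrib prod_power_delta sum.distrib by simp

lemma polynomial_deg_le_bilinear:
  "polynomial_deg_le 2 (\<lambda>v::real^3. k0 + k1 * v $ 1 + k2 * v $ 2 + k3 * v $ 3 + k4 * (v $ 1 * v $ 2))"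
  by (intro polynomial_deg_le_add polynomial_deg_le_scale polynomial_deg_le_const
      polynomial_deg_le_coordinate polynomial_deg_le_coordinate_mult) auto

lemma boolean_combination_mono:
  assumes "boolean_combination P S" "P \<subseteq> Q"
  shows "boolean_combination Q S"
  using assms by (induction rule: boolean_combination.induct)
    (auto intro: boolean_combination.intros)

lemma semialgebraic_deg_le_nonneg:
  assumes "polynomial_deg_le d p"
  shows "semialgebraic_deg_le d {v. p v \<ge> 0}"
  unfolding semialgebraic_deg_le_def
  using assms by (intro exI[of _ "{p}"]) (auto intro: boolean_combination.nonneg)

lemma semialgebraic_deg_le_pos:
  assumes "polynomial_deg_le d p"
  shows "semialgebraic_deg_le d {v. p v > 0}"
  unfolding semialgebraic_deg_le_def
  using assms by (intro exI[of _ "{p}"]) (auto intro: boolean_combination.pos)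

lemma semialgebraic_deg_le_union_inter:
  assumes "semialgebraic_deg_le d S" "semialgebraic_deg_le d T"
  shows "semialgebraic_deg_le d (S \<union> T)" "semialgebraic_deg_le d (S \<inter> T)"
proof -
  obtain P Q where P: "finite P" "\<forall>p\<in>P. polynomial_deg_le d p" "boolean_combination P S"
    and Q: "finite Q" "\<forall>p\<in>Q. polynomial_deg_le d p" "boolean_combination Q T"
    using assms unfolding semialgebraic_deg_le_def by blast
  have "boolean_combination (P \<union> Q) S" "boolean_combination (P \<union> Q) T"
    using P(3) Q(3) by (auto intro: boolean_combination_mono)
  with P Q show "semialgebraic_deg_le d (S \<union> T)" "semialgebraic_deg_le d (S \<inter> T)"
    unfolding semialgebraic_deg_le_def
    by (intro exI[of _ "P \<union> Q"]; auto intro: boolean_combination.union boolean_combination.inter)+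
qed

lemma semialgebraic_deg_le_empty: "semialgebraic_deg_le d ({} :: (real^'n::finite) set)"
  using semialgebraic_deg_le_nonneg[OF polynomial_deg_le_const[of d "-1"]] by simp

lemma semialgebraic_deg_le_UN:
  fixes S :: "'i \<Rightarrow> (real^'n::finite) set"
  assumes "finite I" "\<And>i. i \<in> I \<Longrightarrow> semialgebraic_deg_le d (S i)"
  shows "semialgebraic_deg_le d (\<Union>i\<in>I. S i)"
  using assms
  by (induction I rule: finite_induct)
    (auto intro: semialgebraic_deg_le_empty semialgebraic_deg_le_union_inter)


section \<open>Rank-one convex functions\<close>

abbreviation point :: "real \<Rightarrow> real \<Rightarrow> real \<Rightarrow> real^3"
  where "point x y z \<equiv> vector [x, y, z]"

lemma point_coords: "point (v $ 1) (v $ 2) (v $ 3) = v"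
  by (simp add: vec_eq_iff forall_3)

lemma rank_one_cone_scaleR: "B \<in> rank_one_cone \<Longrightarrow> t *\<^sub>R B \<in> rank_one_cone"
  by (auto simp: rank_one_cone_def)

lemma rank_one_convex_segment:
  assumes "rank_one_convex f" "Q - P \<in> rank_one_cone" "0 \<le> u" "u \<le> 1"
  shows "f ((1 - u) *\<^sub>R P + u *\<^sub>R Q) \<le> (1 - u) * f P + u * f Q"
proof -
  have "convex_on UNIV (\<lambda>t. f (P + t *\<^sub>R (Q - P)))"
    using assms by (auto simp: rank_one_convex_def)
  from convex_onD[OF this, of u 0 1] assms show ?thesis
    by (simp add: algebra_simps)
qed

lemma rank_one_convex_add:
  "rank_one_convex f \<Longrightarrow> rank_one_convex g \<Longrightarrow> rank_one_convex (\<lambda>v. f v + g v)"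
  by (auto simp: rank_one_convex_def intro!: convex_on_add)

lemma convex_on_max:
  fixes f g :: "real \<Rightarrow> real"
  assumes f: "convex_on S f" and g: "convex_on S g"
  shows "convex_on S (\<lambda>x. max (f x) (g x))"
proof (rule convex_onI)
  fix t x y :: real
  assume t: "0 < t" "t < 1" and xy: "x \<in> S" "y \<in> S"
  have "(1 - t) * f x + t * f y \<le> (1 - t) * max (f x) (g x) + t * max (f y) (g y)"
    "(1 - t) * g x + t * g y \<le> (1 - t) * max (f x) (g x) + t * max (f y) (g y)"
    using t by (auto intro!: add_mono mult_left_mono)
  with convex_onD[OF f, of t x y] convex_onD[OF g, of t x y] t xy
  show "max (f ((1 - t) *\<^sub>R x + t *\<^sub>R y)) (g ((1 - t) *\<^sub>R x + t *\<^sub>R y))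
      \<le> (1 - t) * max (f x) (g x) + t * max (f y) (g y)"
    by auto
qed (use f convex_on_imp_convex in blast)

lemma rank_one_convex_max:
  "rank_one_convex f \<Longrightarrow> rank_one_convex g \<Longrightarrow> rank_one_convex (\<lambda>v. max (f v) (g v))"
  by (simp add: rank_one_convex_def convex_on_max)

lemma rank_one_convex_const: "rank_one_convex (\<lambda>_. c)"
  by (simp add: rank_one_convex_def convex_on_const)

lemma convex_on_imp_rank_one_convex:
  fixes f :: "real^3 \<Rightarrow> real"
  assumes "convex_on UNIV f"
  shows "rank_one_convex f"
  unfolding rank_one_convex_def
proof (intro allI ballI convex_onI)
  fix A B :: "real^3" and t x y :: real
  assume "0 < t" "t < 1"
  then show "f (A + ((1 - t) *\<^sub>R x + t *\<^sub>R y) *\<^sub>R B)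
      \<le> (1 - t) * f (A + x *\<^sub>R B) + t * f (A + y *\<^sub>R B)"
    using convex_onD[OF assms, of t "A + x *\<^sub>R B" "A + y *\<^sub>R B"]
    by (simp add: algebra_simps)
qed auto

lemma rank_one_convex_fibre_convex:
  assumes "rank_one_convex f"
  shows "convex_on UNIV (\<lambda>z. f (point x y z))"
proof -
  have "convex_on UNIV (\<lambda>t. f (point x y 0 + t *\<^sub>R point 0 0 1))"
    using assms unfolding rank_one_convex_def by (simp add: rank_one_cone_def)
  moreover have "point x y 0 + t *\<^sub>R point 0 0 1 = point x y t" for t
    by (simp add: vec_eq_iff forall_3)
  ultimately show ?thesis by simp
qed

lemma rank_one_convex_fibre_continuous:
  assumes "rank_one_convex f"
  shows "continuous_on UNIV (\<lambda>z. f (point x y z))"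
  using rank_one_convex_fibre_convex[OF assms] by (intro convex_on_continuous) auto

definition swap_diagonal :: "real^3 \<Rightarrow> real^3"
  where "swap_diagonal v = point (v $ 2) (v $ 1) (v $ 3)"

lemma swap_diagonal_simps [simp]:
  "swap_diagonal (swap_diagonal v) = v"
  "swap_diagonal (point x y z) = point y x z"
  by (simp_all add: swap_diagonal_def vec_eq_iff forall_3)

lemma rank_one_convex_swap:
  assumes "rank_one_convex f"
  shows "rank_one_convex (\<lambda>v. f (swap_diagonal v))"
  unfolding rank_one_convex_def
proof (intro allI ballI)
  fix A B :: "real^3"
  assume "B \<in> rank_one_cone"
  then have "swap_diagonal B \<in> rank_one_cone"
    by (auto simp: rank_one_cone_def swap_diagonal_def)
  with assms have "convex_on UNIV (\<lambda>t. f (swap_diagonal A + t *\<^sub>R swap_diagonal B))"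
    by (simp add: rank_one_convex_def)
  moreover have "swap_diagonal (A + t *\<^sub>R B) = swap_diagonal A + t *\<^sub>R swap_diagonal B" for t
    by (simp add: swap_diagonal_def vec_eq_iff forall_3)
  ultimately show "convex_on UNIV (\<lambda>t. f (swap_diagonal (A + t *\<^sub>R B)))"
    by simp
qed

text \<open>Exchanging the diagonal entries preserves the rank-one cone, so statements about the
  x-direction transfer to the y-direction.\<close>

lemma rank_one_hull_swap: "swap_diagonal v \<in> rank_one_hull (swap_diagonal ` K) \<longleftrightarrow> v \<in> rank_one_hull K"
proof -
  have *: "swap_diagonal v \<in> rank_one_hull (swap_diagonal ` K)" if "v \<in> rank_one_hull K" for v K
    unfolding rank_one_hull_def
  proof (intro CollectI allI impI)
    fix f assume "rank_one_convex f"
    from rank_one_convex_swap[OF this] that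
    show "f (swap_diagonal v) \<le> (SUP B\<in>swap_diagonal ` K. f B)"
      by (auto simp: rank_one_hull_def image_image)
  qed
  from *[of v K] *[of "swap_diagonal v" "swap_diagonal ` K"] show ?thesis
    by (auto simp: image_image)
qed


section \<open>Separating functions\<close>

text \<open>Subtracting the maximum on K and taking the positive part normalises the functions
  that define the hull. In this form they can be added without losing positivity at any point, which
  lets one finite sum do the work of many separating functions.\<close>

definition separator :: "(real^3) set \<Rightarrow> (real^3 \<Rightarrow> real) \<Rightarrow> bool"
  where "separator K f \<longleftrightarrow> rank_one_convex f \<and> (\<forall>v. 0 \<le> f v) \<and> (\<forall>v\<in>K. f v = 0)"

lemma separator_sum:
  assumes "finite I" "\<And>f. f \<in> I \<Longrightarrow> separator K f"
  shows "separator K (\<lambda>v. \<Sum>f\<in>I. f v)"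
  using assms
proof (induction I rule: finite_induct)
  case empty
  show ?case by (simp add: separator_def rank_one_convex_const)
next
  case (insert f I)
  then have f: "separator K f" and I: "separator K (\<lambda>v. \<Sum>f\<in>I. f v)" by auto
  then have "rank_one_convex (\<lambda>v. f v + (\<Sum>f\<in>I. f v))"
    by (intro rank_one_convex_add) (auto simp: separator_def)
  with f I insert.hyps show ?case by (simp add: separator_def)
qed

lemma rank_one_hull_iff_separator:
  assumes "finite K" "K \<noteq> {}"
  shows "v \<in> rank_one_hull K \<longleftrightarrow> (\<forall>f. separator K f \<longrightarrow> f v \<le> 0)"
proof (intro iffI allI impI)
  fix f assume "v \<in> rank_one_hull K" "separator K f"
  moreover from this assms have "(SUP B\<in>K. f B) = 0"
    by (simp add: separator_def cong: image_cong)
  ultimately show "f v \<le> 0"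
    by (auto simp: rank_one_hull_def separator_def)
next
  assume v: "\<forall>f. separator K f \<longrightarrow> f v \<le> 0"
  show "v \<in> rank_one_hull K"
    unfolding rank_one_hull_def
  proof (intro CollectI allI impI)
    fix f assume f: "rank_one_convex f"
    let ?m = "SUP B\<in>K. f B"
    have "f B \<le> ?m" if "B \<in> K" for B
      using assms that by (intro cSUP_upper) auto
    moreover have "rank_one_convex (\<lambda>v. max 0 (f v + - ?m))"
      by (rule rank_one_convex_max[OF rank_one_convex_const
          rank_one_convex_add[OF f rank_one_convex_const]])
    ultimately have "separator K (\<lambda>v. max 0 (f v + - ?m))"
      by (auto simp: separator_def)
    with v have "max 0 (f v + - ?m) \<le> 0" by blast
    then show "f v \<le> ?m" by simp
  qed
qed

lemma convex_coordinate: "convex_on UNIV (\<lambda>v::real^3. k * v $ i)"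
  by (auto intro!: convex_onI simp: algebra_simps)

lemma rank_one_hull_coordinate_bounds:
  assumes "finite K" "K \<noteq> {}" "v \<in> rank_one_hull K"
  shows "Min ((\<lambda>w. w $ i) ` K) \<le> v $ i" "v $ i \<le> Max ((\<lambda>w. w $ i) ` K)"
proof -
  have "v $ i \<le> (SUP B\<in>K. B $ i)"
    using assms(3) convex_on_imp_rank_one_convex[OF convex_coordinate[of 1 i]]
    by (auto simp: rank_one_hull_def)
  then show "v $ i \<le> Max ((\<lambda>w. w $ i) ` K)"
    using assms by (simp add: cSup_eq_Max)
  have "- (v $ i) \<le> (SUP B\<in>K. - (B $ i))"
    using assms(3) convex_on_imp_rank_one_convex[OF convex_coordinate[of "-1" i]]
    by (auto simp: rank_one_hull_def)
  also have "\<dots> \<le> - Min ((\<lambda>w. w $ i) ` K)"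
    using assms by (intro cSUP_least) auto
  finally show "Min ((\<lambda>w. w $ i) ` K) \<le> v $ i" by simp
qed

lemma rank_one_hull_segment:
  assumes "finite K" "K \<noteq> {}" "P \<in> rank_one_hull K" "Q \<in> rank_one_hull K"
    "Q - P \<in> rank_one_cone" "0 \<le> u" "u \<le> 1"
  shows "(1 - u) *\<^sub>R P + u *\<^sub>R Q \<in> rank_one_hull K"
  unfolding rank_one_hull_iff_separator[OF assms(1,2)]
proof (intro allI impI)
  fix f assume f: "separator K f"
  then have "f P \<le> 0" "f Q \<le> 0"
    using assms(3,4) unfolding rank_one_hull_iff_separator[OF assms(1,2)] by auto
  then have "(1 - u) * f P + u * f Q \<le> 0"
    using assms(6,7) by (auto intro!: add_nonpos_nonpos mult_nonneg_nonpos)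
  with rank_one_convex_segment[of f Q P u] f assms show
    "f ((1 - u) *\<^sub>R P + u *\<^sub>R Q) \<le> 0"
    by (auto simp: separator_def)
qed

definition fibre :: "(real^3) set \<Rightarrow> real \<Rightarrow> real \<Rightarrow> real set"
  where "fibre K x y = {z. point x y z \<in> rank_one_hull K}"

lemma fibre_interval:
  assumes "finite K" "K \<noteq> {}"
  obtains l u where "fibre K x y = {l..u}"
proof -
  have "fibre K x y = (\<Inter>f\<in>Collect (separator K). {z. f (point x y z) \<le> 0})"
    by (auto simp: fibre_def rank_one_hull_iff_separator[OF assms])
  also have "closed \<dots>"
    by (intro closed_INT ballI closed_Collect_le[OF rank_one_convex_fibre_continuous continuous_on_const])
      (auto simp: separator_def)
  finally have "closed (fibre K x y)" .
  moreover have "bounded (fibre K x y)"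
  proof (rule bounded_subset[OF bounded_closed_interval])
    show "fibre K x y \<subseteq> {Min ((\<lambda>w. w $ 3) ` K)..Max ((\<lambda>w. w $ 3) ` K)}"
    proof
      fix z assume "z \<in> fibre K x y"
      then have z: "point x y z \<in> rank_one_hull K" by (simp add: fibre_def)
      from rank_one_hull_coordinate_bounds[OF assms z, of 3]
      show "z \<in> {Min ((\<lambda>w. w $ 3) ` K)..Max ((\<lambda>w. w $ 3) ` K)}" by simp
    qed
  qed
  moreover have "convex (fibre K x y)"
    unfolding convex_alt
  proof (intro ballI allI impI)
    fix z w u assume zw: "z \<in> fibre K x y" "w \<in> fibre K x y" "0 \<le> u \<and> u \<le> (1::real)"
    then have "(1 - u) *\<^sub>R point x y z + u *\<^sub>R point x y w \<in> rank_one_hull K"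
      by (intro rank_one_hull_segment assms) (auto simp: fibre_def rank_one_cone_def)
    moreover have "(1 - u) *\<^sub>R point x y z + u *\<^sub>R point x y w
        = point x y ((1 - u) *\<^sub>R z + u *\<^sub>R w)"
      by (simp add: vec_eq_iff forall_3 algebra_simps)
    ultimately show "(1 - u) *\<^sub>R z + u *\<^sub>R w \<in> fibre K x y"
      by (simp add: fibre_def)
  qed
  ultimately show ?thesis
    using connected_compact_interval_1[of "fibre K x y"] that
    by (auto simp: convex_connected compact_eq_bounded_closed)
qed


section \<open>Chordal extension across a strip\<close>

definition frac_between :: "real \<Rightarrow> real \<Rightarrow> real \<Rightarrow> real"
  where "frac_between a b x = (x - a) / (b - a)"

lemma frac_between_bounds:
  assumes "a < b" "a \<le> x" "x \<le> b"
  shows "0 \<le> frac_between a b x" "frac_between a b x \<le> 1"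
  using assms by (auto simp: frac_between_def)

lemma frac_between_affine:
  "frac_between a b ((1 - u) * x + u * y) = (1 - u) * frac_between a b x + u * frac_between a b y"
  by (cases "a = b") (auto simp: frac_between_def divide_simps, auto simp: algebra_simps)

lemma frac_between_combine:
  assumes "a < b"
  shows "(1 - frac_between a b x) * a + frac_between a b x * b = x"
proof -
  have "frac_between a b x * (b - a) = x - a"
    using assms by (simp add: frac_between_def)
  then show ?thesis by (simp add: algebra_simps)
qed

text \<open>The chord from (a, y, z0) to (b, y, z1) has a rank-one direction whatever z0 and z1 are; this
  is the height at parameter t of the chord joining the values of f at its ends.\<close>

definition chord_value :: "real \<Rightarrow> real \<Rightarrow> (real^3 \<Rightarrow> real) \<Rightarrow> real \<Rightarrow> real \<Rightarrow> real \<Rightarrow> real \<Rightarrow> real"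
  where "chord_value a b f y t z0 z1 = (1 - t) * f (point a y z0) + t * f (point b y z1)"

definition chord_values :: "real \<Rightarrow> real \<Rightarrow> (real^3 \<Rightarrow> real) \<Rightarrow> real^3 \<Rightarrow> real set"
  where "chord_values a b f v = (let t = frac_between a b (v $ 1) in
    {chord_value a b f (v $ 2) t z0 z1 |z0 z1. (1 - t) * z0 + t * z1 = v $ 3})"

text \<open>The largest candidate for a rank-one convex function that has the values of f off the open
  strip. Taking the infimum on the closed strip makes the convexity argument there uniform; on the
  bounding planes it returns f itself.\<close>

definition chordal_extension :: "real \<Rightarrow> real \<Rightarrow> (real^3 \<Rightarrow> real) \<Rightarrow> real^3 \<Rightarrow> real"
  where "chordal_extension a b f v =
    (if v $ 1 \<in> {a..b} then Inf (chord_values a b f v) else f v)"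

lemma chord_values_nonempty: "chord_values a b f v \<noteq> {}"
proof -
  let ?t = "frac_between a b (v $ 1)"
  have "(1 - ?t) * v $ 3 + ?t * v $ 3 = v $ 3" by (simp add: algebra_simps)
  then show ?thesis by (auto simp: chord_values_def Let_def)
qed

lemma le_chord_value:
  assumes f: "rank_one_convex f" and "a < b" "x \<in> {a..b}"
    and t: "t = frac_between a b x" and z: "(1 - t) * z0 + t * z1 = z"
  shows "f (point x y z) \<le> chord_value a b f y t z0 z1"
proof -
  have "(1 - t) *\<^sub>R point a y z0 + t *\<^sub>R point b y z1 = point x y z"
    using frac_between_combine[OF \<open>a < b\<close>, of x] z
    by (simp add: vec_eq_iff forall_3 t algebra_simps)
  moreover have "point b y z1 - point a y z0 \<in> rank_one_cone"
    by (simp add: rank_one_cone_def)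
  ultimately show ?thesis
    using rank_one_convex_segment[OF f, of "point b y z1" "point a y z0" t]
      frac_between_bounds[of a b x] assms
    by (simp add: chord_value_def)
qed

lemma le_chord_values:
  assumes "rank_one_convex f" "a < b" "v $ 1 \<in> {a..b}" "w \<in> chord_values a b f v"
  shows "f v \<le> w"
proof -
  obtain z0 z1 where "w = chord_value a b f (v $ 2) (frac_between a b (v $ 1)) z0 z1"
    "(1 - frac_between a b (v $ 1)) * z0 + frac_between a b (v $ 1) * z1 = v $ 3"
    using assms(4) by (auto simp: chord_values_def Let_def)
  with le_chord_value[OF assms(1-3) refl this(2), of "v $ 2"] show ?thesis
    by (simp add: point_coords)
qed

lemma chordal_extension_ge:
  assumes "rank_one_convex f" "a < b"
  shows "f v \<le> chordal_extension a b f v"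
  using le_chord_values[OF assms, of v] chord_values_nonempty[of a b f v]
  by (auto simp: chordal_extension_def intro: cInf_greatest)

lemma chordal_extension_le_chord:
  assumes "rank_one_convex f" "a < b" "v $ 1 \<in> {a..b}"
    "t = frac_between a b (v $ 1)" "(1 - t) * z0 + t * z1 = v $ 3"
  shows "chordal_extension a b f v \<le> chord_value a b f (v $ 2) t z0 z1"
proof -
  have "bdd_below (chord_values a b f v)"
    using le_chord_values[OF assms(1-3)] by (rule bdd_belowI)
  moreover have "chord_value a b f (v $ 2) t z0 z1 \<in> chord_values a b f v"
    using assms(4,5) by (auto simp: chord_values_def Let_def)
  ultimately show ?thesis
    using assms(3) by (auto simp: chordal_extension_def intro: cInf_lower)
qed

lemma chordal_extension_approx:
  assumes "v $ 1 \<in> {a..b}" "t = frac_between a b (v $ 1)" "0 < e"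
  obtains z0 z1 where "(1 - t) * z0 + t * z1 = v $ 3"
    "chord_value a b f (v $ 2) t z0 z1 < chordal_extension a b f v + e"
proof -
  have "Inf (chord_values a b f v) < chordal_extension a b f v + e"
    using assms by (simp add: chordal_extension_def)
  from cInf_lessD[OF chord_values_nonempty this] that assms(2) show ?thesis
    by (auto simp: chord_values_def Let_def)
qed

lemma chordal_extension_eq:
  assumes "rank_one_convex f" "a < b" "v $ 1 \<notin> {a<..<b}"
  shows "chordal_extension a b f v = f v"
proof (cases "v $ 1 \<in> {a..b}")
  case True
  with assms consider "v $ 1 = a" | "v $ 1 = b" by force
  then have "chordal_extension a b f v \<le> f v"
  proof cases
    case 1
    with chordal_extension_le_chord[OF assms(1,2) True refl, of "v $ 3" 0] show ?thesis
      using point_coords[of v] by (simp add: frac_between_def chord_value_def)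
  next
    case 2
    with chordal_extension_le_chord[OF assms(1,2) True refl, of 0 "v $ 3"] show ?thesis
      using point_coords[of v] assms(2) by (simp add: frac_between_def chord_value_def)
  qed
  with chordal_extension_ge[OF assms(1,2), of v] show ?thesis by simp
qed (auto simp: chordal_extension_def)

text \<open>Joint convexity of the perspective of h, with the degenerate weight zero included.
  It is needed because moving along x changes the weights of the two ends of a chord.\<close>

lemma convex_perspective:
  fixes h :: "real \<Rightarrow> real"
  assumes h: "convex_on UNIV h" and "0 \<le> \<alpha>" "0 \<le> \<beta>"
  obtains m where "(\<alpha> + \<beta>) * m = \<alpha> * p + \<beta> * q" "(\<alpha> + \<beta>) * h m \<le> \<alpha> * h p + \<beta> * h q"
proof (cases "\<alpha> + \<beta> = 0")
  case True
  with assms have "\<alpha> = 0" "\<beta> = 0" by auto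
  with that show ?thesis by simp
next
  case False
  with assms have pos: "0 < \<alpha> + \<beta>" by simp
  define u where "u = \<beta> / (\<alpha> + \<beta>)"
  have u: "0 \<le> u" "u \<le> 1" "(\<alpha> + \<beta>) * u = \<beta>" "(\<alpha> + \<beta>) * (1 - u) = \<alpha>"
    using pos assms by (auto simp: u_def divide_simps right_diff_distrib)
  have "h ((1 - u) * p + u * q) \<le> (1 - u) * h p + u * h q"
    using convex_onD[OF h, of u p q] u by simp
  then have "(\<alpha> + \<beta>) * h ((1 - u) * p + u * q) \<le> (\<alpha> + \<beta>) * ((1 - u) * h p + u * h q)"
    using pos by simp
  also have "\<dots> = ((\<alpha> + \<beta>) * (1 - u)) * h p + ((\<alpha> + \<beta>) * u) * h q"
    by (simp add: algebra_simps)
  also have "\<dots> = \<alpha> * h p + \<beta> * h q" using u by simp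
  finally have "(\<alpha> + \<beta>) * h ((1 - u) * p + u * q) \<le> \<alpha> * h p + \<beta> * h q" .
  moreover have "(\<alpha> + \<beta>) * ((1 - u) * p + u * q)
      = ((\<alpha> + \<beta>) * (1 - u)) * p + ((\<alpha> + \<beta>) * u) * q"
    by (simp add: algebra_simps)
  ultimately show ?thesis using that u by simp
qed

text \<open>With x fixed, the weights of the ends are fixed too, and chords can be averaged end by end
  because f is jointly convex in (y, z) on each bounding plane.\<close>

lemma chord_value_combine_vertical:
  assumes f: "rank_one_convex f" and "0 \<le> t" "t \<le> 1" "0 \<le> u" "u \<le> 1"
  shows "chord_value a b f ((1 - u) * y + u * y') t ((1 - u) * p0 + u * q0) ((1 - u) * p1 + u * q1)
    \<le> (1 - u) * chord_value a b f y t p0 p1 + u * chord_value a b f y' t q0 q1"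
proof -
  have seg: "f (point x ((1 - u) * y + u * y') ((1 - u) * p + u * q))
      \<le> (1 - u) * f (point x y p) + u * f (point x y' q)" for x p q
  proof -
    have "(1 - u) *\<^sub>R point x y p + u *\<^sub>R point x y' q
        = point x ((1 - u) * y + u * y') ((1 - u) * p + u * q)"
      by (simp add: vec_eq_iff forall_3 algebra_simps)
    with rank_one_convex_segment[OF f, of "point x y' q" "point x y p" u] assms
    show ?thesis by (simp add: rank_one_cone_def)
  qed
  have "chord_value a b f ((1 - u) * y + u * y') t ((1 - u) * p0 + u * q0) ((1 - u) * p1 + u * q1)
    \<le> (1 - t) * ((1 - u) * f (point a y p0) + u * f (point a y' q0))
      + t * ((1 - u) * f (point b y p1) + u * f (point b y' q1))"
    unfolding chord_value_def using assms seg by (intro add_mono mult_left_mono) auto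
  then show ?thesis by (simp add: chord_value_def algebra_simps)
qed

text \<open>With y fixed the parameters s and t differ, so the averaged chord ends at the weighted
  means of the ends lying in the same bounding plane.\<close>

lemma chord_value_combine_horizontal:
  assumes f: "rank_one_convex f" and s: "0 \<le> s" "s \<le> 1" and t: "0 \<le> t" "t \<le> 1"
    and u: "0 \<le> u" "u \<le> 1" and r: "r = (1 - u) * s + u * t"
  obtains m0 m1 where
    "(1 - r) * m0 + r * m1 = (1 - u) * ((1 - s) * p0 + s * p1) + u * ((1 - t) * q0 + t * q1)"
    "chord_value a b f y r m0 m1
      \<le> (1 - u) * chord_value a b f y s p0 p1 + u * chord_value a b f y t q0 q1"
proof -
  obtain m0 where m0: "((1 - u) * (1 - s) + u * (1 - t)) * m0 = (1 - u) * (1 - s) * p0 + u * (1 - t) * q0"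
    "((1 - u) * (1 - s) + u * (1 - t)) * f (point a y m0)
      \<le> (1 - u) * (1 - s) * f (point a y p0) + u * (1 - t) * f (point a y q0)"
    using convex_perspective[OF rank_one_convex_fibre_convex[OF f],
        of "(1 - u) * (1 - s)" "u * (1 - t)" p0 q0 a y] s t u by auto
  obtain m1 where m1: "((1 - u) * s + u * t) * m1 = (1 - u) * s * p1 + u * t * q1"
    "((1 - u) * s + u * t) * f (point b y m1)
      \<le> (1 - u) * s * f (point b y p1) + u * t * f (point b y q1)"
    using convex_perspective[OF rank_one_convex_fibre_convex[OF f],
        of "(1 - u) * s" "u * t" p1 q1 b y] s t u by auto
  have r': "1 - r = (1 - u) * (1 - s) + u * (1 - t)"
    by (simp add: r algebra_simps)
  show ?thesis
  proof
    show "(1 - r) * m0 + r * m1 = (1 - u) * ((1 - s) * p0 + s * p1) + u * ((1 - t) * q0 + t * q1)"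
    proof -
      have "(1 - r) * m0 = (1 - u) * (1 - s) * p0 + u * (1 - t) * q0"
        using m0(1) by (simp only: r')
      moreover have "r * m1 = (1 - u) * s * p1 + u * t * q1"
        using m1(1) by (simp only: r)
      ultimately show ?thesis by (simp add: algebra_simps)
    qed
    have "(1 - r) * f (point a y m0) + r * f (point b y m1)
      \<le> ((1 - u) * (1 - s) * f (point a y p0) + u * (1 - t) * f (point a y q0))
        + ((1 - u) * s * f (point b y p1) + u * t * f (point b y q1))"
      unfolding r' using m0(2) m1(2) by (simp add: r)
    then show "chord_value a b f y r m0 m1
      \<le> (1 - u) * chord_value a b f y s p0 p1 + u * chord_value a b f y t q0 q1"
      by (simp add: chord_value_def algebra_simps)
  qed
qed

lemma chordal_extension_segment:
  assumes f: "rank_one_convex f" and ab: "a < b"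
    and P: "P $ 1 \<in> {a..b}" and Q: "Q $ 1 \<in> {a..b}"
    and cone: "Q - P \<in> rank_one_cone" and u: "0 \<le> u" "u \<le> 1"
  shows "chordal_extension a b f ((1 - u) *\<^sub>R P + u *\<^sub>R Q)
    \<le> (1 - u) * chordal_extension a b f P + u * chordal_extension a b f Q"
proof (rule field_le_epsilon)
  fix e :: real assume "0 < e"
  define M where "M = (1 - u) *\<^sub>R P + u *\<^sub>R Q"
  define s where "s = frac_between a b (P $ 1)"
  define t where "t = frac_between a b (Q $ 1)"
  define r where "r = frac_between a b (M $ 1)"
  have r: "r = (1 - u) * s + u * t"
    by (simp add: r_def s_def t_def M_def frac_between_affine)
  have M: "M $ i = (1 - u) * P $ i + u * Q $ i" for i by (simp add: M_def)
  have M1: "M $ 1 \<in> {a..b}"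
    using convexD_alt[of "{a..b}" "P $ 1" "Q $ 1" u] P Q u M[of 1] by (simp add: algebra_simps)
  have s01: "0 \<le> s" "s \<le> 1" "0 \<le> t" "t \<le> 1"
    using frac_between_bounds ab P Q by (auto simp: s_def t_def)
  obtain p0 p1 where p: "(1 - s) * p0 + s * p1 = P $ 3"
    "chord_value a b f (P $ 2) s p0 p1 < chordal_extension a b f P + e"
    using chordal_extension_approx[OF P s_def \<open>0 < e\<close>] by blast
  obtain q0 q1 where q: "(1 - t) * q0 + t * q1 = Q $ 3"
    "chord_value a b f (Q $ 2) t q0 q1 < chordal_extension a b f Q + e"
    using chordal_extension_approx[OF Q t_def \<open>0 < e\<close>] by blast
  have "chordal_extension a b f M
    \<le> (1 - u) * chord_value a b f (P $ 2) s p0 p1 + u * chord_value a b f (Q $ 2) t q0 q1"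
  proof (cases "P $ 1 = Q $ 1")
    case True
    then have st: "t = s" "r = s" by (auto simp: s_def t_def r algebra_simps)
    have "(1 - r) * ((1 - u) * p0 + u * q0) + r * ((1 - u) * p1 + u * q1)
      = (1 - u) * ((1 - s) * p0 + s * p1) + u * ((1 - t) * q0 + t * q1)"
      by (simp add: st algebra_simps)
    then have "chordal_extension a b f M
      \<le> chord_value a b f (M $ 2) r ((1 - u) * p0 + u * q0) ((1 - u) * p1 + u * q1)"
      by (intro chordal_extension_le_chord f ab M1 r_def) (simp add: M p q)
    also have "\<dots> \<le> (1 - u) * chord_value a b f (P $ 2) s p0 p1 + u * chord_value a b f (Q $ 2) t q0 q1"
      using chord_value_combine_vertical[OF f s01(1,2) u] by (simp add: M st)
    finally show ?thesis .
  next
    case False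
    with cone have y: "Q $ 2 = P $ 2" by (simp add: rank_one_cone_def)
    then have M2: "M $ 2 = P $ 2" by (simp add: M algebra_simps)
    obtain m0 m1 where m:
      "(1 - r) * m0 + r * m1 = (1 - u) * ((1 - s) * p0 + s * p1) + u * ((1 - t) * q0 + t * q1)"
      "chord_value a b f (P $ 2) r m0 m1
        \<le> (1 - u) * chord_value a b f (P $ 2) s p0 p1 + u * chord_value a b f (P $ 2) t q0 q1"
      using chord_value_combine_horizontal[OF f s01 u r] by blast
    have "chordal_extension a b f M \<le> chord_value a b f (M $ 2) r m0 m1"
      using m(1) by (intro chordal_extension_le_chord f ab M1 r_def) (simp add: M p q)
    with m(2) show ?thesis by (simp add: M2 y)
  qed
  also have "\<dots> \<le> (1 - u) * (chordal_extension a b f P + e) + u * (chordal_extension a b f Q + e)"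
    using p(2) q(2) u by (intro add_mono mult_left_mono) auto
  finally show "chordal_extension a b f ((1 - u) *\<^sub>R P + u *\<^sub>R Q)
    \<le> (1 - u) * chordal_extension a b f P + u * chordal_extension a b f Q + e"
    by (simp add: M_def algebra_simps)
qed

text \<open>Raising a convex function on an interval, without moving it elsewhere, keeps it convex provided
  that the raised part is convex. On a chord from p to q, the points outside the interval lie below
  the chord by convexity of the original function; these include the ends of the interval that the
  chord covers, so convexity on the interval settles the points inside.\<close>

lemma convex_on_raise_between:
  fixes \<phi> \<psi> :: "real \<Rightarrow> real"
  assumes \<psi>: "convex_on UNIV \<psi>" and \<phi>: "convex_on {\<alpha>..\<beta>} \<phi>"
    and ge: "\<And>t. \<psi> t \<le> \<phi> t" and eq: "\<And>t. t \<notin> {\<alpha><..<\<beta>} \<Longrightarrow> \<phi> t = \<psi> t"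
  shows "convex_on UNIV \<phi>"
proof (rule convex_on_linorderI)
  fix u p q :: real
  assume u: "0 < u" "u < 1" and "p < q"
  \<comment> \<open>l is the affine function through the values of \<phi> at p and q.\<close>
  define d where "d = (\<phi> q - \<phi> p) / (q - p)"
  define l where "l t = \<phi> p + d * (t - p)" for t
  have l_affine: "l ((1 - s) * t + s * t') = (1 - s) * l t + s * l t'" for s t t'
    by (simp add: l_def algebra_simps)
  have l_ends: "l p = \<phi> p" "l q = \<phi> q"
    using \<open>p < q\<close> by (auto simp: l_def d_def)
  have param: "\<exists>s. 0 \<le> s \<and> s \<le> 1 \<and> t = (1 - s) * t0 + s * t1"
    if "t0 \<le> t" "t \<le> t1" for t t0 t1 :: real
  proof -
    have "t \<in> closed_segment t0 t1" using that by (simp add: closed_segment_eq_real_ivl)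
    then show ?thesis by (auto simp: closed_segment_def)
  qed
  have outside: "\<phi> t \<le> l t" if t: "t \<notin> {\<alpha><..<\<beta>}" "p \<le> t" "t \<le> q" for t
  proof -
    obtain s where s: "0 \<le> s" "s \<le> 1" "t = (1 - s) * p + s * q"
      using param t by blast
    have "\<phi> t = \<psi> t" using eq t by simp
    also have "\<dots> \<le> (1 - s) * \<psi> p + s * \<psi> q"
      using convex_onD[OF \<psi>, of s p q] s by simp
    also have "\<dots> \<le> (1 - s) * \<phi> p + s * \<phi> q"
      using s ge by (intro add_mono mult_left_mono) auto
    also have "\<dots> = l t" using l_affine[of s p q] s l_ends by simp
    finally show ?thesis .
  qed
  define m where "m = (1 - u) * p + u * q"
  have m: "p \<le> m" "m \<le> q"
    using convexD_alt[of "{p..q}" p q u] u \<open>p < q\<close> by (auto simp: m_def)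
  have "\<phi> m \<le> l m"
  proof (cases "m \<in> {\<alpha><..<\<beta>}")
    case True
    define p' where "p' = max p \<alpha>"
    define q' where "q' = min q \<beta>"
    have "p' \<le> m" "m \<le> q'" using True m by (auto simp: p'_def q'_def)
    then obtain s where s: "0 \<le> s" "s \<le> 1" "m = (1 - s) * p' + s * q'"
      using param by blast
    have "\<phi> p' \<le> l p'"
      using l_ends(1) outside[of \<alpha>] True m by (cases "p \<le> \<alpha>") (auto simp: p'_def)
    moreover have "\<phi> q' \<le> l q'"
      using l_ends(2) outside[of \<beta>] True m by (cases "\<beta> \<le> q") (auto simp: q'_def)
    ultimately have *: "(1 - s) * \<phi> p' + s * \<phi> q' \<le> (1 - s) * l p' + s * l q'"
      using s by (intro add_mono mult_left_mono) auto
    have "\<phi> m \<le> (1 - s) * \<phi> p' + s * \<phi> q'"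
      using convex_onD[OF \<phi>, of s p' q'] s True m by (auto simp: p'_def q'_def)
    with * show ?thesis using l_affine[of s p' q'] s by simp
  qed (use outside m in auto)
  then show "\<phi> ((1 - u) *\<^sub>R p + u *\<^sub>R q) \<le> (1 - u) * \<phi> p + u * \<phi> q"
    using l_affine[of u p q] l_ends by (simp add: m_def)
qed auto

text \<open>A line in a rank-one direction either keeps x constant, and then stays inside or outside the
  strip, or it crosses the strip in an interval of parameters, where the extension raises f.\<close>

lemma rank_one_convex_chordal_extension:
  assumes f: "rank_one_convex f" and ab: "a < b"
  shows "rank_one_convex (chordal_extension a b f)"
  unfolding rank_one_convex_def
proof (intro allI ballI)
  fix A B :: "real^3"
  assume B: "B \<in> rank_one_cone"
  let ?F = "chordal_extension a b f"
  have conv: "convex_on UNIV (\<lambda>t. f (A + t *\<^sub>R B))"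
    using f B by (simp add: rank_one_convex_def)
  have strip: "convex_on I (\<lambda>t. ?F (A + t *\<^sub>R B))"
    if "convex I" "\<And>t. t \<in> I \<Longrightarrow> (A + t *\<^sub>R B) $ 1 \<in> {a..b}" for I :: "real set"
  proof (rule convex_onI)
    fix u p q :: real
    assume "0 < u" "u < 1" "p \<in> I" "q \<in> I"
    moreover have "(A + q *\<^sub>R B) - (A + p *\<^sub>R B) = (q - p) *\<^sub>R B"
      by (simp add: algebra_simps)
    ultimately have "?F ((1 - u) *\<^sub>R (A + p *\<^sub>R B) + u *\<^sub>R (A + q *\<^sub>R B))
        \<le> (1 - u) * ?F (A + p *\<^sub>R B) + u * ?F (A + q *\<^sub>R B)"
      using that(2) B rank_one_cone_scaleR by (intro chordal_extension_segment f ab) auto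
    then show "?F (A + ((1 - u) *\<^sub>R p + u *\<^sub>R q) *\<^sub>R B)
        \<le> (1 - u) * ?F (A + p *\<^sub>R B) + u * ?F (A + q *\<^sub>R B)"
      by (simp add: algebra_simps)
  qed (rule that(1))
  show "convex_on UNIV (\<lambda>t. ?F (A + t *\<^sub>R B))"
  proof (cases "B $ 1 = 0")
    case True
    show ?thesis
    proof (cases "A $ 1 \<in> {a..b}")
      case True
      with \<open>B $ 1 = 0\<close> show ?thesis by (intro strip) auto
    next
      case False
      with \<open>B $ 1 = 0\<close> have "?F (A + t *\<^sub>R B) = f (A + t *\<^sub>R B)" for t
        by (auto simp: chordal_extension_def)
      with conv show ?thesis by simp
    qed
  next
    case False
    define \<alpha> where "\<alpha> = min ((a - A $ 1) / B $ 1) ((b - A $ 1) / B $ 1)"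
    define \<beta> where "\<beta> = max ((a - A $ 1) / B $ 1) ((b - A $ 1) / B $ 1)"
    have inside: "(A + t *\<^sub>R B) $ 1 \<in> {a..b} \<longleftrightarrow> t \<in> {\<alpha>..\<beta>}"
      and open_inside: "(A + t *\<^sub>R B) $ 1 \<in> {a<..<b} \<longleftrightarrow> t \<in> {\<alpha><..<\<beta>}" for t
    proof -
      consider "0 < B $ 1" | "B $ 1 < 0" using False by linarith
      then have "((A + t *\<^sub>R B) $ 1 \<in> {a..b} \<longleftrightarrow> t \<in> {\<alpha>..\<beta>})
        \<and> ((A + t *\<^sub>R B) $ 1 \<in> {a<..<b} \<longleftrightarrow> t \<in> {\<alpha><..<\<beta>})"
      proof cases
        case 1
        then have "\<alpha> = (a - A $ 1) / B $ 1" "\<beta> = (b - A $ 1) / B $ 1"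
          using ab by (simp_all add: \<alpha>_def \<beta>_def min_def max_def divide_le_cancel)
        with 1 show ?thesis by (auto simp: field_simps)
      next
        case 2
        then have "\<alpha> = (b - A $ 1) / B $ 1" "\<beta> = (a - A $ 1) / B $ 1"
          using ab by (simp_all add: \<alpha>_def \<beta>_def min_def max_def divide_le_cancel)
        with 2 show ?thesis by (auto simp: field_simps)
      qed
      then show "(A + t *\<^sub>R B) $ 1 \<in> {a..b} \<longleftrightarrow> t \<in> {\<alpha>..\<beta>}"
        "(A + t *\<^sub>R B) $ 1 \<in> {a<..<b} \<longleftrightarrow> t \<in> {\<alpha><..<\<beta>}" by blast+
    qed
    show ?thesis
    proof (rule convex_on_raise_between[OF conv])
      show "convex_on {\<alpha>..\<beta>} (\<lambda>t. ?F (A + t *\<^sub>R B))"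
        using inside by (intro strip) auto
      show "f (A + t *\<^sub>R B) \<le> ?F (A + t *\<^sub>R B)" for t
        by (rule chordal_extension_ge[OF f ab])
      show "?F (A + t *\<^sub>R B) = f (A + t *\<^sub>R B)" if "t \<notin> {\<alpha><..<\<beta>}" for t
        using that open_inside by (intro chordal_extension_eq f ab) auto
    qed
  qed
qed


section \<open>Fibres over a grid cell\<close>

text \<open>All splittings of z form a line, parametrised by z0. At each of them some separator is positive
  at one of the two ends, and so it is near that splitting. Outside a compact interval of
  values z0, the convex function max 0 (|z| - M), with M large enough that it vanishes on K, gives a
  uniform bound.\<close>

lemma separator_chord_positive:
  assumes K: "finite K" "K \<noteq> {}" and t: "0 < t" "t < 1"
    and miss: "\<And>z0 z1. z0 \<in> fibre K a y \<Longrightarrow> z1 \<in> fibre K b y \<Longrightarrow> (1 - t) * z0 + t * z1 \<noteq> z"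
  obtains f c where "separator K f" "0 < c"
    "\<And>z0 z1. (1 - t) * z0 + t * z1 = z \<Longrightarrow> c \<le> chord_value a b f y t z0 z1"
proof -
  \<comment> \<open>The end z1 that completes z0 = w to a splitting of z.\<close>
  define partner where "partner w = (z - (1 - t) * w) / t" for w
  have partner: "(1 - t) * w + t * partner w = z" for w
    using t by (simp add: partner_def)
  define \<phi> where "\<phi> f w = chord_value a b f y t w (partner w)" for f w
  have \<phi>_cont: "continuous_on UNIV (\<phi> f)" if "separator K f" for f
  proof -
    have f: "rank_one_convex f" using that by (simp add: separator_def)
    have "continuous_on UNIV (\<lambda>w. f (point b y (partner w)))"
      unfolding partner_def using t
      by (intro continuous_on_compose2[OF rank_one_convex_fibre_continuous[OF f]] continuous_intros) auto
    then show ?thesis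
      unfolding \<phi>_def chord_value_def
      by (intro continuous_intros rank_one_convex_fibre_continuous[OF f])
  qed
  have nonneg: "0 \<le> (1 - t) * f (point a y w)" "0 \<le> t * f (point b y w)" if "separator K f" for f w
    using that t by (auto simp: separator_def)
  define M where "M = Max ((\<lambda>v. \<bar>v $ 3\<bar>) ` K)"
  define g where "g v = max (0::real) (max (1 * v $ 3 + - M) ((- 1) * v $ 3 + - M))" for v :: "real^3"
  have "rank_one_convex g"
    unfolding g_def
    by (intro rank_one_convex_max rank_one_convex_add rank_one_convex_const
        convex_on_imp_rank_one_convex convex_coordinate)
  moreover have "\<bar>v $ 3\<bar> \<le> M" if "v \<in> K" for v
    unfolding M_def using K that by (intro Max_ge) auto
  ultimately have g: "separator K g"
    unfolding separator_def by (fastforce simp: g_def)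
  define I where "I = {- (M + 1)..M + 1}"
  have far: "1 - t \<le> (1 - t) * g (point a y w)" if "w \<notin> I" for w
  proof -
    have "1 \<le> g (point a y w)" using that by (auto simp: g_def I_def)
    with t show ?thesis using mult_left_mono[of 1 "g (point a y w)" "1 - t"] by simp
  qed
  have "I \<subseteq> (\<Union>f\<in>Collect (separator K). {w. 0 < \<phi> f w})"
  proof
    fix w
    have "w \<notin> fibre K a y \<or> partner w \<notin> fibre K b y" using miss partner by blast
    then obtain f where f: "separator K f" and "0 < f (point a y w) \<or> 0 < f (point b y (partner w))"
      by (auto simp: fibre_def rank_one_hull_iff_separator[OF K] not_le)
    with t nonneg[OF f, of w] nonneg[OF f, of "partner w"] have "0 < \<phi> f w"
      unfolding \<phi>_def chord_value_def
      by (auto intro: add_pos_nonneg add_nonneg_pos)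
    with f show "w \<in> (\<Union>f\<in>Collect (separator K). {w. 0 < \<phi> f w})" by blast
  qed
  moreover have "open {w. 0 < \<phi> f w}" if "separator K f" for f
    by (intro open_Collect_less continuous_intros \<phi>_cont that)
  moreover have "compact I" by (simp add: I_def)
  ultimately obtain D where D: "D \<subseteq> Collect (separator K)" "finite D"
    "I \<subseteq> (\<Union>f\<in>D. {w. 0 < \<phi> f w})"
    using compactE_image[of I "Collect (separator K)" "\<lambda>f. {w. 0 < \<phi> f w}"] by auto
  define h where "h v = (\<Sum>f\<in>insert g D. f v)" for v
  have h: "separator K h"
    unfolding h_def using D g by (intro separator_sum) auto
  have h_ge: "f v \<le> h v" if "f \<in> insert g D" for f v
    unfolding h_def using that D g by (intro member_le_sum) (auto simp: separator_def)
  have \<phi>_mono: "\<phi> f w \<le> \<phi> h w" if "f \<in> insert g D" for f w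
    unfolding \<phi>_def chord_value_def using h_ge[OF that] t by (intro add_mono mult_left_mono) auto
  have h_pos: "0 < \<phi> h w" if "w \<in> I" for w
  proof -
    from that D(3) obtain f where "f \<in> D" "0 < \<phi> f w" by blast
    with \<phi>_mono[of f w] show ?thesis by simp
  qed
  obtain c where c: "0 < c" "\<And>w. w \<in> I \<Longrightarrow> c \<le> \<phi> h w"
  proof (cases "I = {}")
    case True
    with that[of 1] show ?thesis by simp
  next
    case False
    have "continuous_on I (\<phi> h)" by (rule continuous_on_subset[OF \<phi>_cont[OF h]]) simp
    from continuous_attains_inf[OF \<open>compact I\<close> False this] obtain w0 where
      "w0 \<in> I" "\<And>w. w \<in> I \<Longrightarrow> \<phi> h w0 \<le> \<phi> h w" by blast
    with that[of "\<phi> h w0"] h_pos show ?thesis by blast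
  qed
  have "min c (1 - t) \<le> \<phi> h w" for w
  proof (cases "w \<in> I")
    case False
    have "1 - t \<le> \<phi> g w"
      using far[OF False] nonneg[OF g, of "partner w"] by (simp add: \<phi>_def chord_value_def)
    with \<phi>_mono[of g w] show ?thesis by simp
  qed (use c in fastforce)
  moreover have "z1 = partner z0" if "(1 - t) * z0 + t * z1 = z" for z0 z1
    using that t by (auto simp: partner_def)
  ultimately have "min c (1 - t) \<le> chord_value a b h y t z0 z1" if "(1 - t) * z0 + t * z1 = z" for z0 z1
    using that by (metis \<phi>_def)
  with that[OF h, of "min c (1 - t)"] c(1) t show ?thesis by simp
qed

definition mix :: "real \<Rightarrow> real set \<Rightarrow> real set \<Rightarrow> real set"
  where "mix t A B = {(1 - t) * z0 + t * z1 |z0 z1. z0 \<in> A \<and> z1 \<in> B}"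

text \<open>If z admitted no splitting into the two outer fibres, a separator with a positive lower bound
  on all chords through (x, y, z) would exist. Its chordal extension inherits that bound, and it still
  vanishes on K because K avoids the open strip.\<close>

lemma fibre_strip_subset:
  assumes K: "finite K" "K \<noteq> {}" and x: "x \<in> {a<..<b}"
    and gap: "\<And>v. v \<in> K \<Longrightarrow> v $ 1 \<notin> {a<..<b}"
  shows "fibre K x y \<subseteq> mix (frac_between a b x) (fibre K a y) (fibre K b y)"
proof
  fix z assume "z \<in> fibre K x y"
  then have hull: "point x y z \<in> rank_one_hull K" by (simp add: fibre_def)
  have ab: "a < b" using x by simp
  define t where "t = frac_between a b x"
  have t: "0 < t" "t < 1" using x by (auto simp: t_def frac_between_def)
  show "z \<in> mix (frac_between a b x) (fibre K a y) (fibre K b y)"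
  proof (rule ccontr)
    assume "z \<notin> mix (frac_between a b x) (fibre K a y) (fibre K b y)"
    then have "(1 - t) * z0 + t * z1 \<noteq> z" if "z0 \<in> fibre K a y" "z1 \<in> fibre K b y" for z0 z1
      using that unfolding mix_def t_def by blast
    from separator_chord_positive[OF K t this] obtain f c where f: "separator K f" and "0 < c"
      and c: "\<And>z0 z1. (1 - t) * z0 + t * z1 = z \<Longrightarrow> c \<le> chord_value a b f y t z0 z1" by blast
    have roc: "rank_one_convex f" using f by (simp add: separator_def)
    let ?F = "chordal_extension a b f"
    have "separator K ?F"
      using f rank_one_convex_chordal_extension[OF roc ab] chordal_extension_ge[OF roc ab]
        chordal_extension_eq[OF roc ab] gap
      unfolding separator_def by (metis order_trans)
    with hull have "?F (point x y z) \<le> 0"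
      by (simp add: rank_one_hull_iff_separator[OF K])
    moreover have "c \<le> ?F (point x y z)"
    proof -
      have "c \<le> Inf (chord_values a b f (point x y z))"
        using c by (intro cInf_greatest chord_values_nonempty)
          (auto simp: chord_values_def Let_def t_def)
      with x show ?thesis by (simp add: chordal_extension_def)
    qed
    ultimately show False using \<open>0 < c\<close> by simp
  qed
qed

text \<open>Letting a = b stand for the single point a treats grid lines and the gaps between them alike;
  in that case the interpolation parameter is 0, because division by zero yields 0, so
  that interpolating returns the value at a.\<close>

definition grid_cell :: "real \<Rightarrow> real \<Rightarrow> real set"
  where "grid_cell a b = (if a = b then {a} else {a<..<b})"

lemma fibre_strip:
  assumes K: "finite K" "K \<noteq> {}" and x: "x \<in> grid_cell a b"
    and gap: "\<And>v. v \<in> K \<Longrightarrow> v $ 1 \<notin> {a<..<b}"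
  shows "fibre K x y = mix (frac_between a b x) (fibre K a y) (fibre K b y)"
proof (cases "a = b")
  case True
  with x show ?thesis by (auto simp: grid_cell_def mix_def frac_between_def)
next
  case False
  with x have x: "x \<in> {a<..<b}" by (simp add: grid_cell_def)
  define t where "t = frac_between a b x"
  have t: "0 \<le> t" "t \<le> 1" using x frac_between_bounds[of a b x] by (auto simp: t_def)
  have "(1 - t) * z0 + t * z1 \<in> fibre K x y" if "z0 \<in> fibre K a y" "z1 \<in> fibre K b y" for z0 z1
  proof -
    have "(1 - t) *\<^sub>R point a y z0 + t *\<^sub>R point b y z1 \<in> rank_one_hull K"
      using that t by (intro rank_one_hull_segment K) (auto simp: fibre_def rank_one_cone_def)
    moreover have "(1 - t) *\<^sub>R point a y z0 + t *\<^sub>R point b y z1 = point x y ((1 - t) * z0 + t * z1)"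
      using frac_between_combine[of a b x] x
      by (simp add: vec_eq_iff forall_3 t_def algebra_simps)
    ultimately show ?thesis by (simp add: fibre_def)
  qed
  then show ?thesis
    using fibre_strip_subset[OF K x gap, of y] by (auto simp: mix_def t_def)
qed

lemma fibre_swap: "fibre (swap_diagonal ` K) y x = fibre K x y"
  using rank_one_hull_swap[of "point x y _" K] by (auto simp: fibre_def)

lemma fibre_strip_swapped:
  assumes K: "finite K" "K \<noteq> {}" and y: "y \<in> grid_cell c d"
    and gap: "\<And>v. v \<in> K \<Longrightarrow> v $ 2 \<notin> {c<..<d}"
  shows "fibre K x y = mix (frac_between c d y) (fibre K x c) (fibre K x d)"
proof -
  have "v $ 1 \<notin> {c<..<d}" if "v \<in> swap_diagonal ` K" for v
    using that gap by (auto simp: swap_diagonal_def)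
  with fibre_strip[of "swap_diagonal ` K" y c d x] K y show ?thesis
    by (simp add: fibre_swap)
qed

lemma mix_intervals:
  fixes l0 :: real
  assumes "0 \<le> t" "t \<le> 1" "l0 \<le> u0" "l1 \<le> u1"
  shows "mix t {l0..u0} {l1..u1} = {(1 - t) * l0 + t * l1..(1 - t) * u0 + t * u1}"
proof
  show "mix t {l0..u0} {l1..u1} \<subseteq> {(1 - t) * l0 + t * l1..(1 - t) * u0 + t * u1}"
    using assms by (auto simp: mix_def intro!: add_mono mult_left_mono)
  show "{(1 - t) * l0 + t * l1..(1 - t) * u0 + t * u1} \<subseteq> mix t {l0..u0} {l1..u1}"
  proof
    fix z assume "z \<in> {(1 - t) * l0 + t * l1..(1 - t) * u0 + t * u1}"
    then have "z \<in> closed_segment ((1 - t) * l0 + t * l1) ((1 - t) * u0 + t * u1)"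
      by (auto simp: closed_segment_eq_real_ivl)
    then obtain s where s: "0 \<le> s" "s \<le> 1"
      "z = (1 - s) * ((1 - t) * l0 + t * l1) + s * ((1 - t) * u0 + t * u1)"
      by (auto simp: closed_segment_def)
    have "z = (1 - t) * ((1 - s) * l0 + s * u0) + t * ((1 - s) * l1 + s * u1)"
      by (simp add: s algebra_simps)
    moreover have "(1 - s) * l0 + s * u0 \<in> {l0..u0}" "(1 - s) * l1 + s * u1 \<in> {l1..u1}"
      using convexD_alt[of "{l0..u0}" l0 u0 s] convexD_alt[of "{l1..u1}" l1 u1 s] s assms by auto
    ultimately show "z \<in> mix t {l0..u0} {l1..u1}" by (auto simp: mix_def)
  qed
qed

lemma mix_empty [simp]: "mix t {} B = {}" "mix t A {} = {}"
  by (auto simp: mix_def)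

definition bilinear_interpolation ::
  "real \<Rightarrow> real \<Rightarrow> real \<Rightarrow> real \<Rightarrow> real \<Rightarrow> real \<Rightarrow> real \<Rightarrow> real \<Rightarrow> real^3 \<Rightarrow> real"
  where "bilinear_interpolation a b c d w00 w10 w01 w11 v =
    (let s = frac_between a b (v $ 1); t = frac_between c d (v $ 2)
     in (1 - t) * ((1 - s) * w00 + s * w10) + t * ((1 - s) * w01 + s * w11))"

lemma polynomial_deg_le_bilinear_interpolation:
  "polynomial_deg_le 2 (\<lambda>v. k * v $ 3 + l * bilinear_interpolation a b c d w00 w10 w01 w11 v)"
proof -
  \<comment> \<open>Inverses instead of quotients keep the identity valid for a = b or c = d.\<close>
  define p where "p = inverse (b - a)"
  define q where "q = inverse (d - c)"
  define m where "m = w00 - w10 - w01 + w11"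
  have "k * v $ 3 + l * bilinear_interpolation a b c d w00 w10 w01 w11 v
    = l * (w00 - (w10 - w00) * p * a - (w01 - w00) * q * c + m * p * a * q * c)
      + l * ((w10 - w00) * p - m * p * q * c) * v $ 1
      + l * ((w01 - w00) * q - m * p * q * a) * v $ 2
      + k * v $ 3 + l * m * p * q * (v $ 1 * v $ 2)" for v :: "real^3"
    by (simp add: bilinear_interpolation_def Let_def frac_between_def divide_inverse
        p_def[symmetric] q_def[symmetric] m_def algebra_simps)
  then show ?thesis by (simp only: polynomial_deg_le_bilinear)
qed

lemma semialgebraic_grid_cell:
  assumes "i = 1 \<or> i = 2"
  shows "semialgebraic_deg_le 2 {v::real^3. v $ i \<in> grid_cell a b}"
proof -
  have poly: "polynomial_deg_le 2 (\<lambda>v::real^3. v $ i - k)" "polynomial_deg_le 2 (\<lambda>v::real^3. k - v $ i)" for k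
    using assms polynomial_deg_le_bilinear[of "-k" 1 0 0 0] polynomial_deg_le_bilinear[of "-k" 0 1 0 0]
      polynomial_deg_le_bilinear[of k "-1" 0 0 0] polynomial_deg_le_bilinear[of k 0 "-1" 0 0]
    by auto
  show ?thesis
  proof (cases "a = b")
    case True
    then have "{v::real^3. v $ i \<in> grid_cell a b} = {v. v $ i - a \<ge> 0} \<inter> {v. a - v $ i \<ge> 0}"
      by (auto simp: grid_cell_def)
    also have "semialgebraic_deg_le 2 \<dots>"
      by (intro semialgebraic_deg_le_union_inter semialgebraic_deg_le_nonneg poly)
    finally show ?thesis .
  next
    case False
    then have "{v::real^3. v $ i \<in> grid_cell a b} = {v. v $ i - a > 0} \<inter> {v. b - v $ i > 0}"
      by (auto simp: grid_cell_def)
    also have "semialgebraic_deg_le 2 \<dots>"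
      by (intro semialgebraic_deg_le_union_inter semialgebraic_deg_le_pos poly)
    finally show ?thesis .
  qed
qed

text \<open>Interpolating first in y and then in x expresses every fibre over the cell by the four corner
  fibres. Cells with an empty corner fibre contribute nothing.\<close>

lemma semialgebraic_hull_over_cell:
  assumes K: "finite K" "K \<noteq> {}"
    and gap: "\<And>v. v \<in> K \<Longrightarrow> v $ 1 \<notin> {a<..<b}" "\<And>v. v \<in> K \<Longrightarrow> v $ 2 \<notin> {c<..<d}"
  shows "semialgebraic_deg_le 2
    (rank_one_hull K \<inter> {v. v $ 1 \<in> grid_cell a b} \<inter> {v. v $ 2 \<in> grid_cell c d})"
    (is "semialgebraic_deg_le 2 ?S")
proof -
  have mem: "v \<in> ?S \<longleftrightarrow> v $ 1 \<in> grid_cell a b \<and> v $ 2 \<in> grid_cell c d \<and>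
    v $ 3 \<in> mix (frac_between c d (v $ 2))
      (mix (frac_between a b (v $ 1)) (fibre K a c) (fibre K b c))
      (mix (frac_between a b (v $ 1)) (fibre K a d) (fibre K b d))" for v
  proof -
    have "v \<in> ?S \<longleftrightarrow> v $ 1 \<in> grid_cell a b \<and> v $ 2 \<in> grid_cell c d \<and> v $ 3 \<in> fibre K (v $ 1) (v $ 2)"
      by (auto simp: fibre_def point_coords)
    then show ?thesis
      using fibre_strip_swapped[OF K _ gap(2), of "v $ 2" "v $ 1"]
        fibre_strip[OF K _ gap(1), of "v $ 1"] by auto
  qed
  show ?thesis
  proof (cases "fibre K a c = {} \<or> fibre K b c = {} \<or> fibre K a d = {} \<or> fibre K b d = {}")
    case True
    then have "?S = {}" using mem by auto
    then show ?thesis by (simp add: semialgebraic_deg_le_empty)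
  next
    case False
    obtain l00 u00 where I00: "fibre K a c = {l00..u00}" using fibre_interval[OF K] .
    obtain l10 u10 where I10: "fibre K b c = {l10..u10}" using fibre_interval[OF K] .
    obtain l01 u01 where I01: "fibre K a d = {l01..u01}" using fibre_interval[OF K] .
    obtain l11 u11 where I11: "fibre K b d = {l11..u11}" using fibre_interval[OF K] .
    have ord: "l00 \<le> u00" "l10 \<le> u10" "l01 \<le> u01" "l11 \<le> u11"
      using False I00 I10 I01 I11 by auto
    let ?L = "bilinear_interpolation a b c d l00 l10 l01 l11"
    let ?U = "bilinear_interpolation a b c d u00 u10 u01 u11"
    have frac: "0 \<le> frac_between p q x \<and> frac_between p q x \<le> 1" if "x \<in> grid_cell p q" for p q x
      using that frac_between_bounds[of p q x]
      by (auto simp: grid_cell_def frac_between_def split: if_splits)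
    have "v \<in> ?S \<longleftrightarrow> v $ 1 \<in> grid_cell a b \<and> v $ 2 \<in> grid_cell c d \<and> ?L v \<le> v $ 3 \<and> v $ 3 \<le> ?U v" for v
    proof (cases "v $ 1 \<in> grid_cell a b \<and> v $ 2 \<in> grid_cell c d")
      case True
      define s where "s = frac_between a b (v $ 1)"
      define t where "t = frac_between c d (v $ 2)"
      have s: "0 \<le> s" "s \<le> 1" and t: "0 \<le> t" "t \<le> 1"
        using True frac by (auto simp: s_def t_def)
      have "(1 - s) * l00 + s * l10 \<le> (1 - s) * u00 + s * u10"
        "(1 - s) * l01 + s * l11 \<le> (1 - s) * u01 + s * u11"
        using s ord by (auto intro!: add_mono mult_left_mono)
      then have "mix t (mix s {l00..u00} {l10..u10}) (mix s {l01..u01} {l11..u11}) = {?L v..?U v}"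
        using s t ord by (simp add: mix_intervals bilinear_interpolation_def Let_def s_def t_def)
      with True show ?thesis
        unfolding mem[of v] I00 I10 I01 I11 by (simp add: s_def t_def)
    qed auto
    then have "?S = {v. v $ 1 \<in> grid_cell a b} \<inter> {v. v $ 2 \<in> grid_cell c d}
      \<inter> {v. 1 * v $ 3 + (- 1) * ?L v \<ge> 0} \<inter> {v. (- 1) * v $ 3 + 1 * ?U v \<ge> 0}"
      by auto
    also have "semialgebraic_deg_le 2 \<dots>"
      by (intro semialgebraic_deg_le_union_inter semialgebraic_grid_cell semialgebraic_deg_le_nonneg
          polynomial_deg_le_bilinear_interpolation) auto
    finally show ?thesis .
  qed
qed

definition grid_cells :: "real set \<Rightarrow> (real \<times> real) set"
  where "grid_cells X = {(a, b). a \<in> X \<and> b \<in> X \<and> a \<le> b \<and> X \<inter> {a<..<b} = {}}"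

lemma finite_grid_cells: "finite X \<Longrightarrow> finite (grid_cells X)"
  by (rule finite_subset[of _ "X \<times> X"]) (auto simp: grid_cells_def)

lemma grid_cells_cover:
  assumes X: "finite X" "X \<noteq> {}" and x: "Min X \<le> x" "x \<le> Max X"
  obtains a b where "(a, b) \<in> grid_cells X" "x \<in> grid_cell a b"
proof (cases "x \<in> X")
  case True
  with that[of x x] show ?thesis by (auto simp: grid_cells_def grid_cell_def)
next
  case False
  define L where "L = {w \<in> X. w < x}"
  define R where "R = {w \<in> X. x < w}"
  have "Min X \<in> L" "Max X \<in> R"
    using x False Min_in[OF X] Max_in[OF X] unfolding L_def R_def less_le by blast+
  moreover have fin: "finite L" "finite R" using X by (auto simp: L_def R_def)
  ultimately have in_LR: "Max L \<in> L" "Min R \<in> R" by (auto intro!: Max_in Min_in)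
  have "w \<notin> {Max L<..<Min R}" if "w \<in> X" for w
  proof -
    have "w \<in> L \<or> w \<in> R"
      using that False by (cases w x rule: linorder_cases) (auto simp: L_def R_def)
    with fin show ?thesis by (auto dest: Max_ge Min_le)
  qed
  then have "X \<inter> {Max L<..<Min R} = {}" by blast
  moreover have "Max L \<in> X" "Max L < x" "Min R \<in> X" "x < Min R"
    using in_LR by (simp_all add: L_def R_def)
  ultimately show ?thesis
    using that[of "Max L" "Min R"] by (simp add: grid_cells_def grid_cell_def)
qed

theorem semialgebraic_rank_one_hull:
  assumes "finite K"
  shows "semialgebraic_deg_le 2 (rank_one_hull K)"
proof (cases "K = {}")
  case True
  then show ?thesis by (simp add: rank_one_hull_empty semialgebraic_deg_le_empty)
next
  case False
  define X where "X i = (\<lambda>v. v $ i) ` K" for i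
  have X: "finite (X i)" "X i \<noteq> {}" for i using assms False by (auto simp: X_def)
  define piece where "piece = (\<lambda>((a, b), (c, d)).
    rank_one_hull K \<inter> {v. v $ 1 \<in> grid_cell a b} \<inter> {v. v $ 2 \<in> grid_cell c d})"
  have "rank_one_hull K = (\<Union>p\<in>grid_cells (X 1) \<times> grid_cells (X 2). piece p)"
  proof
    show "rank_one_hull K \<subseteq> (\<Union>p\<in>grid_cells (X 1) \<times> grid_cells (X 2). piece p)"
    proof
      fix v assume v: "v \<in> rank_one_hull K"
      note bounds = rank_one_hull_coordinate_bounds[OF assms False v, folded X_def]
      obtain a b where "(a, b) \<in> grid_cells (X 1)" "v $ 1 \<in> grid_cell a b"
        using grid_cells_cover[OF X bounds] .
      moreover obtain c d where "(c, d) \<in> grid_cells (X 2)" "v $ 2 \<in> grid_cell c d"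
        using grid_cells_cover[OF X bounds] .
      ultimately show "v \<in> (\<Union>p\<in>grid_cells (X 1) \<times> grid_cells (X 2). piece p)"
        using v by (intro UN_I[of "((a, b), (c, d))"]) (auto simp: piece_def)
    qed
  qed (auto simp: piece_def)
  also have "semialgebraic_deg_le 2 \<dots>"
  proof (rule semialgebraic_deg_le_UN)
    show "finite (grid_cells (X 1) \<times> grid_cells (X 2))"
      using X finite_grid_cells by blast
    fix p assume "p \<in> grid_cells (X 1) \<times> grid_cells (X 2)"
    then obtain a b c d where p: "p = ((a, b), (c, d))"
      "(a, b) \<in> grid_cells (X 1)" "(c, d) \<in> grid_cells (X 2)" by auto
    show "semialgebraic_deg_le 2 (piece p)"
      unfolding p(1) piece_def prod.case
      using p(2,3) by (intro semialgebraic_hull_over_cell assms False)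
        (auto simp: grid_cells_def X_def)
  qed
  finally show ?thesis .
qed

theorem theorem1p4:
  fixes K :: "(real^2^2) set"
  assumes "finite K"
    and "\<And>A. A \<in> K \<Longrightarrow> upper_triangular2 A"
  shows "semialgebraic_deg_le 2 (rank_one_hull (tri_coords ` K))"
  using assms(1) by (intro semialgebraic_rank_one_hull finite_imageI)

end
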